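(* Let $A_1,\dots,A_4$ and $B_1,\dots,B_4$ be collinear points, respectively. By avoiding two of the points $A_i,B_i$ (with the same index $i$), the remaining six points form a hexagon $H_i$ with sides $A_j\times B_k$, $i\ne j\ne k\ne i$. The intersections of opposite sides of the hexagon $H_i$ (that is, the points $(A_j\times B_k)\times(A_k\times B_j)$) lie on a Pappus line $p_i$. Then two of these Pappus lines $p_1,p_2,p_3,p_4$ (and hence all four) coincide if and only if $$\operatorname{CR}(A_1,A_2;A_3,A_4)=\operatorname{CR}(B_1,B_2;B_3,B_4).$$
   Context: The setting is the projective plane; $A_1,\dots,A_4$ lie on a line and $B_1,\dots,B_4$ lie on a line. $A\times B$ denotes the line through the points $A$ and $B$, and $g\times h$ the intersection point of the lines $g$ and $h$. The cross-ratio of four collinear points is $\operatorname{CR}(A,B;C,D)=\frac{AC}{CB}\cdot\frac{BD}{DA}$, where the fractions are quotients of oriented lengths of segments on an oriented line. *)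

theory Defs
  imports "HOL-Analysis.Analysis"
begin

section \<open>The real projective plane\<close>

text \<open>
  Points and lines are the one- and two-dimensional linear subspaces of \<open>\<real>\<^sup>3\<close>;
  incidence is inclusion. The ordinary point \<open>(x, y)\<close> is \<open>span {vector [x, y, 1]}\<close>.
\<close>

definition proj_point :: "(real^3) set \<Rightarrow> bool" where
  "proj_point P \<longleftrightarrow> subspace P \<and> dim P = 1"

definition proj_line :: "(real^3) set \<Rightarrow> bool" where
  "proj_line g \<longleftrightarrow> subspace g \<and> dim g = 2"

definition join :: "(real^3) set \<Rightarrow> (real^3) set \<Rightarrow> (real^3) set" where
  "join P Q = span (P \<union> Q)"

definition meet :: "(real^3) set \<Rightarrow> (real^3) set \<Rightarrow> (real^3) set" where
  "meet g h = g \<inter> h"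

lemma proj_line_join:
  assumes "proj_point P" "proj_point Q" "P \<noteq> Q"
  shows "proj_line (join P Q)"
proof -
  have P: "subspace P" "dim P = 1" and Q: "subspace Q" "dim Q = 1"
    using assms by (auto simp: proj_point_def)
  have "dim (P \<inter> Q) \<noteq> 1"
    using subspace_dim_equal[of "P \<inter> Q" P] subspace_dim_equal[of "P \<inter> Q" Q]
      P Q assms(3) subspace_inter[of P Q] by auto
  moreover have "dim (P \<inter> Q) \<le> 1"
    using dim_subset[of "P \<inter> Q" P] P by auto
  ultimately have "dim (P \<inter> Q) = 0" by linarith
  moreover have "join P Q = {x + y |x y. x \<in> P \<and> y \<in> Q}"
    unfolding join_def span_Un span_eq_iff[THEN iffD2, OF P(1)] span_eq_iff[THEN iffD2, OF Q(1)] ..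
  moreover have "dim {x + y |x y. x \<in> P \<and> y \<in> Q} + dim (P \<inter> Q) = 1 + 1"
    using dim_sums_Int[OF P(1) Q(1)] unfolding P(2) Q(2) .
  ultimately have "dim (join P Q) = 2"
    by (simp only:)
  then show ?thesis by (simp add: proj_line_def join_def)
qed

lemma proj_point_meet:
  assumes "proj_line g" "proj_line h" "g \<noteq> h"
  shows "proj_point (meet g h)"
proof -
  have g: "subspace g" "dim g = 2" and h: "subspace h" "dim h = 2"
    using assms by (auto simp: proj_line_def)
  have "dim (g \<inter> h) \<noteq> 2"
    using subspace_dim_equal[of "g \<inter> h" g] subspace_dim_equal[of "g \<inter> h" h]
      g h assms(3) subspace_inter[of g h] by auto
  moreover have "dim (g \<inter> h) \<le> 2"
    using dim_subset[of "g \<inter> h" g] g by auto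
  moreover have "dim {x + y |x y. x \<in> g \<and> y \<in> h} \<le> 3"
    using dim_subset_UNIV[of "{x + y |x y. x \<in> g \<and> y \<in> h}"] by simp
  ultimately have "dim (g \<inter> h) = 1"
    using dim_sums_Int[OF g(1) h(1)] g h by linarith
  then show ?thesis
    using subspace_inter[OF g(1) h(1)] by (simp add: proj_point_def meet_def)
qed


section \<open>Cross-ratio\<close>

text \<open>
  The oriented length \<open>AC\<close> is the difference \<open>c - a\<close> of coordinates on the line. To admit
  points at infinity, an arbitrary affine coordinate \<open>t\<close> on the projective line is used:
  \<open>span {u + t *\<^sub>R v}\<close> for a basis \<open>u, v\<close> of the line, subject only to the four given
  points having finite coordinates. By \<open>cross_ratio_eq\<close> below the value does not depend on the
  choice, and by \<open>cross_ratio_oriented_lengths\<close> it is the Euclidean one at ordinary points.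
\<close>

definition cross_ratio ::
  "(real^3) set \<Rightarrow> (real^3) set \<Rightarrow> (real^3) set \<Rightarrow> (real^3) set \<Rightarrow> real" where
  "cross_ratio A B C D =
    (THE r. \<exists>u v a b c d. u \<noteq> v \<and> independent {u, v} \<and>
       A = span {u + a *\<^sub>R v} \<and> B = span {u + b *\<^sub>R v} \<and>
       C = span {u + c *\<^sub>R v} \<and> D = span {u + d *\<^sub>R v} \<and>
       r = (c - a) / (b - c) * ((d - b) / (a - d)))"

lemma independent_pair_imp_cross3_nonzero:
  fixes u v :: "real^3"
  assumes "u \<noteq> v" "independent {u, v}"
  shows "cross3 u v \<noteq> 0"
proof
  assume "cross3 u v = 0"
  then have "u = 0 \<or> v = 0 \<or> (\<exists>c. v = c *\<^sub>R u)"
    by (simp add: cross_eq_0 collinear_lemma)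
  moreover have "u \<noteq> 0" "v \<noteq> 0"
    using assms(2) dependent_zero by blast+
  ultimately obtain c where "v = c *\<^sub>R u" by blast
  then have "v \<in> span {u}" by (simp add: span_base span_scale)
  moreover have "v \<notin> span {u}"
    using assms independent_insert[of v "{u}"] by (simp add: insert_commute)
  ultimately show False by simp
qed

lemma cross_ratio_eq:
  assumes "u \<noteq> v" "independent {u, v}"
    and "A = span {u + a *\<^sub>R v}" "B = span {u + b *\<^sub>R v}"
        "C = span {u + c *\<^sub>R v}" "D = span {u + d *\<^sub>R v}"
  shows "cross_ratio A B C D = (c - a) / (b - c) * ((d - b) / (a - d))"
  unfolding cross_ratio_def
proof (rule the_equality)
  show "\<exists>u v a' b' c' d'. u \<noteq> v \<and> independent {u, v} \<and>
       A = span {u + a' *\<^sub>R v} \<and> B = span {u + b' *\<^sub>R v} \<and>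
       C = span {u + c' *\<^sub>R v} \<and> D = span {u + d' *\<^sub>R v} \<and>
       (c - a) / (b - c) * ((d - b) / (a - d)) = (c' - a') / (b' - c') * ((d' - b') / (a' - d'))"
    using assms by blast
next
  fix r
  assume "\<exists>u v a b c d. u \<noteq> v \<and> independent {u, v} \<and>
       A = span {u + a *\<^sub>R v} \<and> B = span {u + b *\<^sub>R v} \<and>
       C = span {u + c *\<^sub>R v} \<and> D = span {u + d *\<^sub>R v} \<and>
       r = (c - a) / (b - c) * ((d - b) / (a - d))"
  then obtain u' v' a' b' c' d' where uv': "u' \<noteq> v'" "independent {u', v'}"
    and P: "A = span {u' + a' *\<^sub>R v'}" "B = span {u' + b' *\<^sub>R v'}"
       "C = span {u' + c' *\<^sub>R v'}" "D = span {u' + d' *\<^sub>R v'}"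
    and r: "r = (c' - a') / (b' - c') * ((d' - b') / (a' - d'))"
    by blast
  have n: "cross3 u v \<noteq> 0" and n': "cross3 u' v' \<noteq> 0"
    using assms uv' independent_pair_imp_cross3_nonzero by blast+
  have br: "cross3 (x + s *\<^sub>R y) (x + t *\<^sub>R y) = (t - s) *\<^sub>R cross3 x y" for x y :: "real^3" and s t
    by (simp add: cross3_simps forall_3)
  have nz: "u' + t *\<^sub>R v' \<noteq> 0" for t
    using br[of u' t v' "t + 1"] n' by auto
  have rep: "\<exists>k. k \<noteq> 0 \<and> u' + s' *\<^sub>R v' = k *\<^sub>R (u + s *\<^sub>R v)"
    if "span {u + s *\<^sub>R v} = span {u' + s' *\<^sub>R v'}" for s s'
  proof -
    have "u' + s' *\<^sub>R v' \<in> span {u + s *\<^sub>R v}"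
      using that span_base by blast
    then obtain k where "u' + s' *\<^sub>R v' = k *\<^sub>R (u + s *\<^sub>R v)"
      by (auto simp: span_singleton)
    then show ?thesis using nz[of s'] by (metis scaleR_zero_left)
  qed
  obtain ka kb kc kd where k0: "ka \<noteq> 0" "kb \<noteq> 0" "kc \<noteq> 0" "kd \<noteq> 0"
    and k: "u' + a' *\<^sub>R v' = ka *\<^sub>R (u + a *\<^sub>R v)" "u' + b' *\<^sub>R v' = kb *\<^sub>R (u + b *\<^sub>R v)"
      "u' + c' *\<^sub>R v' = kc *\<^sub>R (u + c *\<^sub>R v)" "u' + d' *\<^sub>R v' = kd *\<^sub>R (u + d *\<^sub>R v)"
    using rep[of a a'] rep[of b b'] rep[of c c'] rep[of d d'] assms P by metis
  define N where "N = cross3 u v \<bullet> cross3 u v"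
  define m where "m = cross3 u' v' \<bullet> cross3 u v"
  have N: "N \<noteq> 0" using n by (simp add: N_def)
  have vec: "(t' - s') *\<^sub>R cross3 u' v' = (ks * kt * (t - s)) *\<^sub>R cross3 u v"
    if "u' + s' *\<^sub>R v' = ks *\<^sub>R (u + s *\<^sub>R v)" "u' + t' *\<^sub>R v' = kt *\<^sub>R (u + t *\<^sub>R v)"
    for s s' t t' ks kt
    using br[of u' s' v' t'] br[of u s v t] unfolding that
    by (simp add: cross_mult_left cross_mult_right ac_simps)
  have sc: "(t' - s') * m = ks * kt * (t - s) * N"
    if "u' + s' *\<^sub>R v' = ks *\<^sub>R (u + s *\<^sub>R v)" "u' + t' *\<^sub>R v' = kt *\<^sub>R (u + t *\<^sub>R v)"
    for s s' t t' ks kt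
    using arg_cong[OF vec[OF that], of "\<lambda>x. x \<bullet> cross3 u v"] by (simp add: m_def N_def)
  have ac: "(c' - a') * m = ka * kc * (c - a) * N" by (rule sc[OF k(1) k(3)])
  have cb: "(b' - c') * m = kc * kb * (b - c) * N" by (rule sc[OF k(3) k(2)])
  have bd: "(d' - b') * m = kb * kd * (d - b) * N" by (rule sc[OF k(2) k(4)])
  have da: "(a' - d') * m = kd * ka * (a - d) * N" by (rule sc[OF k(4) k(1)])
  show "r = (c - a) / (b - c) * ((d - b) / (a - d))"
  proof (cases "m = 0")
    case True
    then have "c = a" using ac k0 N by simp
    then have "(c' - a') *\<^sub>R cross3 u' v' = 0" using vec[OF k(1) k(3)] by simp
    then have "c' = a'" using n' by simp
    then show ?thesis using r \<open>c = a\<close> by simp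
  next
    case False
    define q where "q = N / m"
    have q: "q \<noteq> 0" using N False by (simp add: q_def)
    have "c' - a' = ka * kc * (c - a) * q" "b' - c' = kc * kb * (b - c) * q"
      "d' - b' = kb * kd * (d - b) * q" "a' - d' = kd * ka * (a - d) * q"
      using ac cb bd da False by (simp_all add: q_def field_simps)
    then show ?thesis using r k0 q by simp
  qed
qed

text \<open>Four points \<open>X + t *\<^sub>R e\<close> of the Euclidean line through \<open>X\<close> oriented by the unit vector \<open>e\<close>.\<close>

lemma cross_ratio_oriented_lengths:
  fixes X e :: "real^2" and a b c d :: real
  assumes "norm e = 1"
  defines "pt \<equiv> \<lambda>t. span {vector [(X + t *\<^sub>R e) $ 1, (X + t *\<^sub>R e) $ 2, 1] :: real^3}"
  shows "cross_ratio (pt a) (pt b) (pt c) (pt d) = (c - a) / (b - c) * ((d - b) / (a - d))"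
proof -
  define u v :: "real^3" where "u = vector [X $ 1, X $ 2, 1]" and "v = vector [e $ 1, e $ 2, 0]"
  have "e \<noteq> 0" using assms(1) by auto
  then have "v \<noteq> 0" by (auto simp: v_def vec_eq_iff forall_2 forall_3)
  moreover have "u \<notin> span {v}"
    by (auto simp: span_singleton u_def v_def vec_eq_iff forall_3)
  ultimately have "u \<noteq> v" "independent {u, v}"
    using span_base[of v "{v}"] independent_insert[of u "{v}"] by (auto simp: dependent_single)
  moreover have "pt t = span {u + t *\<^sub>R v}" for t
    unfolding pt_def u_def v_def
    by (rule arg_cong[where f = "\<lambda>x. span {x}"]) (simp add: vec_eq_iff forall_3)
  ultimately show ?thesis by (intro cross_ratio_eq) auto
qed


section \<open>Pappus lines\<close>

text \<open>
  Omitting the index \<open>i\<close>, the hexagon on the remaining points has the pairs of opposite sides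
  \<open>join (A j) (B k)\<close> and \<open>join (A k) (B j)\<close>.
\<close>

definition is_pappus_line ::
  "(nat \<Rightarrow> (real^3) set) \<Rightarrow> (nat \<Rightarrow> (real^3) set) \<Rightarrow> nat \<Rightarrow> (real^3) set \<Rightarrow> bool" where
  "is_pappus_line A B i p \<longleftrightarrow> proj_line p \<and>
    (\<forall>j\<in>{1..4}. \<forall>k\<in>{1..4}. i \<noteq> j \<and> j \<noteq> k \<and> k \<noteq> i \<longrightarrow>
       meet (join (A j) (B k)) (join (A k) (B j)) \<subseteq> p)"

definition pappus_line ::
  "(nat \<Rightarrow> (real^3) set) \<Rightarrow> (nat \<Rightarrow> (real^3) set) \<Rightarrow> nat \<Rightarrow> (real^3) set" where
  "pappus_line A B i = (THE p. is_pappus_line A B i p)"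

end

theory Submission
  imports Defs
begin

text \<open>
  Let \<open>e0\<close> span the common point of the two carrier lines, and write the points as
  \<open>p i e0 + q i e1\<close> and \<open>r i e0 + s i e2\<close>. The Segre map sends \<open>(A i, B i)\<close> to the point
  \<open>(F i, w i)\<close> of projective 3-space, with \<open>F i = p r e0 + q r e1 + p s e2\<close> and \<open>w i = q s\<close>. A direct
  computation shows that the meet of opposite sides with indices \<open>j\<close>, \<open>k\<close> is
  \<open>w k F j - w j F k\<close>, that is, the intersection of the line through the Segre points \<open>j\<close>, \<open>k\<close>
  with the plane \<open>w = 0\<close>. So a Pappus line is the trace in \<open>w = 0\<close> of the plane through three
  Segre points (which reproves Pappus' theorem), and two of them coincide iff the four Segre points
  are coplanar. Their determinant \<open>D\<close> vanishes exactly when the two cross-ratios agree.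
\<close>

section \<open>Lines, spans and normal vectors\<close>

lemma cross3_nonzero_imp_independent:
  fixes u v :: "real^3"
  assumes "cross3 u v \<noteq> 0"
  shows "u \<noteq> v" "independent {u, v}"
proof -
  show "u \<noteq> v" using assms by auto
  have "v \<noteq> 0" using assms by auto
  moreover have "u \<notin> span {v}" using assms by (auto simp: span_singleton cross_mult_left)
  ultimately show "independent {u, v}" by (simp add: independent_insert)
qed

text \<open>Both sides are two-dimensional and contain the independent vectors \<open>P\<close> and
  \<open>Q\<close>, so both equal their span. This reduces equality of lines to incidence of two
  points.\<close>

lemma cross3_hyperplane_eq:
  assumes "proj_line g" "P \<in> g" "Q \<in> g" "cross3 P Q \<noteq> 0"
  shows "g = {x. cross3 P Q \<bullet> x = 0}"
proof -
  note ind = cross3_nonzero_imp_independent[OF assms(4)]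
  have "dim (span {P, Q}) = 2" using ind by (simp add: dim_eq_card_independent)
  then have "span {P, Q} = g"
    using assms(1-3) by (intro subspace_dim_equal) (auto simp: proj_line_def span_minimal)
  moreover have "dim {x. cross3 P Q \<bullet> x = 0} = 2"
    using dim_hyperplane[OF assms(4)] by simp
  then have "span {P, Q} = {x. cross3 P Q \<bullet> x = 0}"
    using ind span_minimal[of "{P, Q}" "{x. cross3 P Q \<bullet> x = 0}"]
    by (intro subspace_dim_equal)
      (auto simp: subspace_hyperplane dim_eq_card_independent dot_cross_self)
  ultimately show ?thesis by simp
qed

lemma proj_line_hyperplane: "n \<noteq> 0 \<Longrightarrow> proj_line {x. n \<bullet> x = 0}"
  using dim_hyperplane[of n] by (simp add: proj_line_def subspace_hyperplane)

lemma proj_point_obtain: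
  assumes "proj_point P"
  obtains x where "x \<noteq> 0" "P = span {x}"
proof -
  have P: "subspace P" "dim P = 1" using assms by (auto simp: proj_point_def)
  obtain B where B: "B \<subseteq> P" "independent B" "P \<subseteq> span B" "card B = dim P"
    using basis_exists by blast
  then obtain x where x: "B = {x}" using P(2) by (metis card_1_singletonE)
  have "x \<noteq> 0" using B(2) x dependent_zero by blast
  moreover have "P = span {x}" using B x P(1) span_minimal by blast
  ultimately show ?thesis using that by blast
qed

lemma proj_point_eq_span:
  assumes "proj_point P" "x \<in> P" "x \<noteq> 0"
  shows "P = span {x}"
  using assms
  by (intro subspace_dim_equal[symmetric]) (auto simp: proj_point_def span_minimal)

lemma span_singleton_eqI:
  fixes x y :: "real^3"
  assumes "x = c *\<^sub>R y" "c \<noteq> 0"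
  shows "span {x} = span {y}"
  using span_image_scale[of "{y}" "\<lambda>_. c"] assms by simp

section \<open>Cross-ratio in homogeneous coordinates\<close>

lemma cross_ratio_homogeneous:
  fixes e f :: "real^3" and p q :: "nat \<Rightarrow> real"
  assumes ef: "e \<noteq> f" "independent {e, f}"
    and nz: "\<And>i. i \<in> {1..4} \<Longrightarrow> p i \<noteq> 0 \<or> q i \<noteq> 0"
    and A: "\<And>i. i \<in> {1..4} \<Longrightarrow> A i = span {p i *\<^sub>R e + q i *\<^sub>R f}"
  shows "cross_ratio (A 1) (A 2) (A 3) (A 4) =
    ((p 1 * q 3 - p 3 * q 1) * (p 2 * q 4 - p 4 * q 2)) /
    ((p 3 * q 2 - p 2 * q 3) * (p 4 * q 1 - p 1 * q 4))"
proof -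
  \<comment> \<open>The vector \<open>f - t *\<^sub>R e\<close> will be the point at infinity of a
    new affine coordinate, so \<open>t\<close> must avoid the value that would put it at one of the
    four points. For \<open>q i = 0\<close> the excluded value is 0 by convention, which does no
    harm.\<close>
  have "finite ((\<lambda>i. - p i / q i) ` {1..4::nat})" by simp
  then obtain t where t: "t \<notin> (\<lambda>i. - p i / q i) ` {1..4::nat}"
    using ex_new_if_finite[OF infinite_UNIV_char_0] by blast
  have n: "p i + t * q i \<noteq> 0" if "i \<in> {1..4}" for i
  proof
    assume 0: "p i + t * q i = 0"
    then have "q i \<noteq> 0" using nz[OF that] by auto
    then have "t = - p i / q i" using 0 by (simp add: field_simps)
    then show False using t that by blast
  qed
  define c where "c i = q i / (p i + t * q i)" for i
  have "A i = span {e + c i *\<^sub>R (f - t *\<^sub>R e)}" if i: "i \<in> {1..4}" for i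
    unfolding A[OF i]
  proof (rule span_singleton_eqI)
    have "p i *\<^sub>R e + q i *\<^sub>R f = (p i + t * q i) *\<^sub>R e + q i *\<^sub>R (f - t *\<^sub>R e)"
      by (simp add: algebra_simps)
    also have "q i *\<^sub>R (f - t *\<^sub>R e) = ((p i + t * q i) * c i) *\<^sub>R (f - t *\<^sub>R e)" using n[OF i] by (simp add: c_def)
    finally show "p i *\<^sub>R e + q i *\<^sub>R f = (p i + t * q i) *\<^sub>R (e + c i *\<^sub>R (f - t *\<^sub>R e))"
      by (simp only: scaleR_add_right scaleR_scaleR)
  qed (rule n[OF i])
  moreover have "cross3 e (f - t *\<^sub>R e) \<noteq> 0"
    using independent_pair_imp_cross3_nonzero[OF ef] by (simp add: cross3_simps)
  then have "e \<noteq> f - t *\<^sub>R e" "independent {e, f - t *\<^sub>R e}"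
    by (rule cross3_nonzero_imp_independent)+
  ultimately have "cross_ratio (A 1) (A 2) (A 3) (A 4) =
     (c 3 - c 1) / (c 2 - c 3) * ((c 4 - c 2) / (c 1 - c 4))"
    by (intro cross_ratio_eq) auto
  \<comment> \<open>Every index occurs once above and once below the fraction bar of the
    cross-ratio, so the factors \<open>p i + t * q i\<close> cancel and only the brackets
    remain.\<close>
  moreover have d: "c j - c i = (p i * q j - p j * q i) / ((p i + t * q i) * (p j + t * q j))"
    if "i \<in> {1..4}" "j \<in> {1..4}" for i j
    using n[OF that(1)] n[OF that(2)] by (simp add: c_def field_simps)
  ultimately show ?thesis
    using n[of 1] n[of 2] n[of 3] n[of 4] by (simp add: d)
qed

lemma obtain_other_index:
  obtains j where "j \<in> {1..4::nat}" "i \<noteq> j"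
proof (cases "i = 1")
  case True
  then show ?thesis using that[of 2] by simp
next
  case False
  then show ?thesis using that[of 1] by simp
qed

text \<open>\<open>q i = 0\<close> means that \<open>A i\<close> is the common point of the two
  carrier lines, \<open>s j = 0\<close> that \<open>B j\<close> is. \<open>A i = B i\<close> remains
  possible at that point.\<close>

locale pappus_coords =
  fixes e0 e1 e2 :: "real^3" and p q r s :: "nat \<Rightarrow> real" and A B :: "nat \<Rightarrow> (real^3) set"
  assumes basis: "cross3 e0 e1 \<bullet> e2 \<noteq> 0"
    and A: "i \<in> {1..4} \<Longrightarrow> A i = span {p i *\<^sub>R e0 + q i *\<^sub>R e1}"
    and B: "i \<in> {1..4} \<Longrightarrow> B i = span {r i *\<^sub>R e0 + s i *\<^sub>R e2}"
    and A_point: "i \<in> {1..4} \<Longrightarrow> proj_point (A i)"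
    and B_point: "i \<in> {1..4} \<Longrightarrow> proj_point (B i)"
    and A_bracket: "i \<in> {1..4} \<Longrightarrow> j \<in> {1..4} \<Longrightarrow> i \<noteq> j \<Longrightarrow> p i * q j - p j * q i \<noteq> 0"
    and B_bracket: "i \<in> {1..4} \<Longrightarrow> j \<in> {1..4} \<Longrightarrow> i \<noteq> j \<Longrightarrow> r i * s j - r j * s i \<noteq> 0"
    and A_ne_B: "i \<in> {1..4} \<Longrightarrow> j \<in> {1..4} \<Longrightarrow> i \<noteq> j \<Longrightarrow> A i \<noteq> B j"
    and qs: "i \<in> {1..4} \<Longrightarrow> j \<in> {1..4} \<Longrightarrow> i \<noteq> j \<Longrightarrow> q i \<noteq> 0 \<or> s j \<noteq> 0"
begin

section \<open>Segre points and the meets of opposite sides\<close>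

definition F :: "nat \<Rightarrow> real^3" where
  "F i = (p i * r i) *\<^sub>R e0 + (q i * r i) *\<^sub>R e1 + (p i * s i) *\<^sub>R e2"

definition w :: "nat \<Rightarrow> real" where "w i = q i * s i"

definition P :: "nat \<Rightarrow> nat \<Rightarrow> real^3" where "P j k = w k *\<^sub>R F j - w j *\<^sub>R F k"

text \<open>The determinant of the four vectors \<open>(F _, w _)\<close>, written through the brackets of the cross-ratios.\<close>

definition D :: "nat \<Rightarrow> nat \<Rightarrow> nat \<Rightarrow> nat \<Rightarrow> real" where
  "D i j k l =
    (p i * q k - p k * q i) * (p j * q l - p l * q j) * ((r k * s j - r j * s k) * (r l * s i - r i * s l)) -
    (r i * s k - r k * s i) * (r j * s l - r l * s j) * ((p k * q j - p j * q k) * (p l * q i - p i * q l))"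

lemma P_swap: "P k j = - P j k"
  by (simp add: P_def)

text \<open>Two zeros would place two of the \<open>A\<close>, two of the \<open>B\<close>, or an
  \<open>A\<close> and a \<open>B\<close> of different index at the common point of the carrier
  lines.\<close>

lemma w_nonzero:
  assumes "i \<in> {1..4}" "j \<in> {1..4}" "i \<noteq> j"
  shows "w i \<noteq> 0 \<or> w j \<noteq> 0"
  using qs[OF assms] qs[OF assms(2,1)] A_bracket[OF assms] B_bracket[OF assms] assms(3)
  by (auto simp: w_def)

text \<open>The right-hand side combines a vector of \<open>A j\<close> with one of
  \<open>B k\<close>, so \<open>P j k\<close> is on that side of the hexagon; by
  \<open>P_swap\<close> it is on the opposite side too.\<close>

lemma P_decomp:
  "P j k = (q k * (r j * s k - r k * s j)) *\<^sub>R (p j *\<^sub>R e0 + q j *\<^sub>R e1) +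
    (s j * (p j * q k - p k * q j)) *\<^sub>R (r k *\<^sub>R e0 + s k *\<^sub>R e2)"
  by (simp add: P_def F_def w_def algebra_simps)

text \<open>Contracting \<open>x \<otimes> y\<close> with the covectors that annihilate \<open>A k\<close> and \<open>B l\<close>, restricted to \<open>w = 0\<close>.\<close>

definition contraction :: "nat \<Rightarrow> nat \<Rightarrow> real^3" where
  "contraction k l = (q k * s l) *\<^sub>R cross3 e1 e2 - (p k * s l) *\<^sub>R cross3 e2 e0 - (q k * r l) *\<^sub>R cross3 e0 e1"

lemma contraction_F:
  "contraction k l \<bullet> F m = ((p m * q k - p k * q m) * (r m * s l - r l * s m) - p k * r l * w m) *
    (cross3 e0 e1 \<bullet> e2)"
  unfolding contraction_def F_def w_def
  by (simp add: cross3_def inner_vec_def sum_3 algebra_simps)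

text \<open>\<open>P m n\<close> has vanishing \<open>w\<close>-coordinate, so the correction terms
  with \<open>p k * r l\<close> in \<open>contraction_F\<close> cancel and only products of brackets
  are left.\<close>

lemma contraction_P:
  "contraction k l \<bullet> P m n =
    (w n * ((p m * q k - p k * q m) * (r m * s l - r l * s m)) -
     w m * ((p n * q k - p k * q n) * (r n * s l - r l * s n))) * (cross3 e0 e1 \<bullet> e2)"
  unfolding P_def inner_diff inner_scaleR_right contraction_F by (simp add: algebra_simps)

text \<open>Each of \<open>contraction k l\<close> and \<open>contraction m k\<close> annihilates
  exactly one of the two vectors, which are therefore independent.\<close>

lemma cross3_P_nonzero:
  assumes "m \<in> {1..4}" "k \<in> {1..4}" "l \<in> {1..4}" "distinct [m, k, l]" "w k \<noteq> 0"
  shows "cross3 (P m k) (P k l) \<noteq> 0"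
proof
  assume 0: "cross3 (P m k) (P k l) = 0"
  have x: "contraction k l \<bullet> P m k \<noteq> 0" "contraction k l \<bullet> P k l = 0"
    "contraction m k \<bullet> P k l \<noteq> 0" "contraction m k \<bullet> P m k = 0"
    using assms A_bracket B_bracket basis by (auto simp: contraction_P)
  show False
    using 0 x by (auto simp: cross_eq_0 collinear_lemma)
qed

lemma P_nonzero:
  assumes "j \<in> {1..4}" "k \<in> {1..4}" "j \<noteq> k"
  shows "P j k \<noteq> 0"
proof
  assume 0: "P j k = 0"
  have "w k \<noteq> 0 \<Longrightarrow> contraction k k \<bullet> P j k \<noteq> 0" "w j \<noteq> 0 \<Longrightarrow> contraction j j \<bullet> P j k \<noteq> 0"
    using assms A_bracket B_bracket basis by (auto simp: contraction_P)
  then show False using 0 w_nonzero[OF assms] by auto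
qed

lemma P_in_join:
  assumes "j \<in> {1..4}" "k \<in> {1..4}"
  shows "P j k \<in> join (A j) (B k)"
proof -
  have "p j *\<^sub>R e0 + q j *\<^sub>R e1 \<in> A j" "r k *\<^sub>R e0 + s k *\<^sub>R e2 \<in> B k"
    by (simp_all add: A[OF assms(1)] B[OF assms(2)] span_base)
  then show ?thesis
    unfolding join_def P_decomp by (metis UnI1 UnI2 span_add span_base span_scale)
qed

text \<open>A common side would contain \<open>A j\<close> and \<open>A k\<close>, hence be the
  carrier line of the \<open>A\<close>. Then \<open>B j\<close> and \<open>B k\<close> would both be
  its intersection with the other carrier line.\<close>

lemma join_ne:
  assumes "j \<in> {1..4}" "k \<in> {1..4}" "j \<noteq> k"
  shows "join (A j) (B k) \<noteq> join (A k) (B j)"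
proof
  assume eq: "join (A j) (B k) = join (A k) (B j)"
  let ?x = "\<lambda>i. p i *\<^sub>R e0 + q i *\<^sub>R e1" and ?y = "\<lambda>i. r i *\<^sub>R e0 + s i *\<^sub>R e2"
  have xin: "?x i \<in> A i" if "i \<in> {1..4}" for i using that by (simp add: A span_base)
  have yin: "?y i \<in> B i" if "i \<in> {1..4}" for i using that by (simp add: B span_base)
  define g where "g = join (A j) (B k)"
  have mem: "?x j \<in> g" "?y k \<in> g" "?x k \<in> g" "?y j \<in> g"
    using xin[OF assms(1)] yin[OF assms(2)] unfolding g_def join_def
      apply (auto intro: span_base)[2]
    using xin[OF assms(2)] yin[OF assms(1)] unfolding eq[unfolded join_def]
      by (auto intro: span_base)
  have g: "proj_line g"
    unfolding g_def using A_ne_B assms A_point B_point by (intro proj_line_join) auto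
  have c: "cross3 (?x j) (?x k) = (p j * q k - p k * q j) *\<^sub>R cross3 e0 e1"
    by (simp add: cross3_simps forall_3)
  have "cross3 e0 e1 \<noteq> 0" using basis by auto
  then have "cross3 (?x j) (?x k) \<noteq> 0" unfolding c using A_bracket[OF assms] by simp
  from cross3_hyperplane_eq[OF g mem(1) mem(3) this] mem(2,4)
  have "cross3 e0 e1 \<bullet> ?y k = 0" "cross3 e0 e1 \<bullet> ?y j = 0"
    unfolding c using A_bracket[OF assms] by auto
  then have "s k = 0" "s j = 0"
    using basis by (auto simp: inner_add dot_cross_self)
  then show False using B_bracket[OF assms] by simp
qed

lemma meet_joins:
  assumes "j \<in> {1..4}" "k \<in> {1..4}" "j \<noteq> k"
  shows "meet (join (A j) (B k)) (join (A k) (B j)) = span {P j k}"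
proof (rule proj_point_eq_span)
  show "proj_point (meet (join (A j) (B k)) (join (A k) (B j)))"
    using assms A_ne_B A_point B_point join_ne
    by (intro proj_point_meet proj_line_join) auto
  have "P j k \<in> join (A k) (B j)"
    using P_in_join[OF assms(2,1)] unfolding P_swap[of j k] join_def by (simp add: span_neg)
  then show "P j k \<in> meet (join (A j) (B k)) (join (A k) (B j))"
    using P_in_join[OF assms(1,2)] by (simp add: meet_def)
qed (rule P_nonzero[OF assms])

section \<open>Existence and uniqueness of the Pappus lines\<close>

lemma is_pappus_line_iff_P:
  "is_pappus_line A B i g \<longleftrightarrow> proj_line g \<and>
    (\<forall>j\<in>{1..4}. \<forall>k\<in>{1..4}. i \<noteq> j \<and> j \<noteq> k \<and> k \<noteq> i \<longrightarrow> P j k \<in> g)"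
proof -
  have "span {P j k} \<subseteq> g \<longleftrightarrow> P j k \<in> g" if "proj_line g" for j k
    using that span_minimal[of "{P j k}" g] span_base[of "P j k" "{P j k}"]
    by (auto simp: proj_line_def)
  then show ?thesis unfolding is_pappus_line_def by (auto simp: meet_joins)
qed

text \<open>This linear dependence of the three meets is the theorem of Pappus.\<close>

lemma P_relation: "w l *\<^sub>R P m k + w m *\<^sub>R P k l + w k *\<^sub>R P l m = 0"
  by (simp add: P_def algebra_simps)

text \<open>\<open>P m k\<close> and \<open>P k l\<close> are independent and so determine the line;
  \<open>P_relation\<close>, solved for \<open>P l m\<close>, puts the third meet on it. Both steps
  use \<open>w k \<noteq> 0\<close>.\<close>

lemma is_pappus_line_iff:
  assumes "{i, m, k, l} = {1..4}" "distinct [i, m, k, l]" "w k \<noteq> 0"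
  shows "is_pappus_line A B i g \<longleftrightarrow> g = {x. cross3 (P m k) (P k l) \<bullet> x = 0}"
proof -
  let ?h = "{x. cross3 (P m k) (P k l) \<bullet> x = 0}"
  have mkl: "m \<in> {1..4}" "k \<in> {1..4}" "l \<in> {1..4}" unfolding assms(1)[symmetric] by auto
  have nz: "cross3 (P m k) (P k l) \<noteq> 0"
    using cross3_P_nonzero mkl assms by auto
  have h: "P m k \<in> ?h" "P k l \<in> ?h" by (simp_all add: dot_cross_self)
  have sub: "subspace ?h" by (rule subspace_hyperplane)
  have "w k *\<^sub>R P l m = - (w l *\<^sub>R P m k + w m *\<^sub>R P k l)"
    using P_relation[of l m k] by (simp only: eq_neg_iff_add_eq_0 add.commute)
  also have "\<dots> \<in> ?h" using h by (intro subspace_neg[OF sub] subspace_add[OF sub] subspace_scale[OF sub])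
  finally have lm: "P l m \<in> ?h" using assms(3) by simp
  moreover have "P k m \<in> ?h" "P l k \<in> ?h" "P m l \<in> ?h"
    unfolding P_swap[of k m] P_swap[of l k] P_swap[of m l]
    using h lm subspace_neg[OF sub] by blast+
  ultimately have "\<forall>u\<in>{i, m, k, l}. \<forall>v\<in>{i, m, k, l}. i \<noteq> u \<and> u \<noteq> v \<and> v \<noteq> i \<longrightarrow> P u v \<in> ?h"
    using h unfolding ball_simps by blast
  then have "is_pappus_line A B i ?h"
    using proj_line_hyperplane[OF nz] unfolding is_pappus_line_iff_P assms(1) by blast
  moreover have "g = ?h" if "is_pappus_line A B i g"
    using that mkl assms(2) nz unfolding is_pappus_line_iff_P
    by (intro cross3_hyperplane_eq) auto
  ultimately show ?thesis by blast
qed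

section \<open>Coincidence of two Pappus lines as a determinant condition\<close>

lemma triple_F:
  "cross3 (F i) (F j) \<bullet> F k =
    (p i * r i * (q j * r j * (p k * s k) - q k * r k * (p j * s j))
     - q i * r i * (p j * r j * (p k * s k) - p k * r k * (p j * s j))
     + p i * s i * (p j * r j * (q k * r k) - p k * r k * (q j * r j))) * (cross3 e0 e1 \<bullet> e2)"
proof -
  have "cross3 (x *\<^sub>R e0 + y *\<^sub>R e1 + z *\<^sub>R e2) (x' *\<^sub>R e0 + y' *\<^sub>R e1 + z' *\<^sub>R e2) \<bullet>
      (x'' *\<^sub>R e0 + y'' *\<^sub>R e1 + z'' *\<^sub>R e2) =
    (x * (y' * z'' - y'' * z') - y * (x' * z'' - x'' * z') + z * (x' * y'' - x'' * y')) *
    (cross3 e0 e1 \<bullet> e2)" for x y z x' y' z' x'' y'' z''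
    by (simp add: cross3_def inner_vec_def sum_3 algebra_simps)
  then show ?thesis unfolding F_def .
qed

lemma triple_P:
  "cross3 (P m k) (P k l) \<bullet> P i k = (w k)\<^sup>2 * D i m k l * (cross3 e0 e1 \<bullet> e2)"
proof -
  \<comment> \<open>Eliminating the \<open>w\<close>-column of the 4x4 determinant with row
    \<open>k\<close> as pivot leaves the vectors \<open>P\<close>. The bracket on the right is the
    expansion of that determinant along the column.\<close>
  have *: "cross3 (a *\<^sub>R x - b *\<^sub>R y) (c *\<^sub>R y - a *\<^sub>R z) \<bullet> (a *\<^sub>R t - d *\<^sub>R y) =
    a\<^sup>2 * (b * (cross3 y z \<bullet> t) + c * (cross3 x y \<bullet> t) + d * (cross3 x z \<bullet> y) - a * (cross3 x z \<bullet> t))"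
    for a b c d and x y z t :: "real^3"
    by (simp add: cross3_def inner_vec_def sum_3 algebra_simps power2_eq_square)
  show ?thesis
    unfolding P_def * triple_F D_def w_def by (simp add: algebra_simps)
qed

text \<open>Like a determinant, \<open>D\<close> changes sign under transpositions of neighbouring
  arguments, and these generate all permutations.\<close>

lemma D_perm:
  assumes "{i, m, k, l} = {1..4}" "distinct [i, m, k, l]"
  shows "D i m k l = 0 \<longleftrightarrow> D 1 2 3 4 = 0"
proof -
  have D: "D j i k l = - D i j k l" "D i k j l = - D i j k l" "D i j l k = - D i j k l" for i j k l
    by (simp_all add: D_def algebra_simps)
  have zero: "D j i k l = 0 \<longleftrightarrow> D i j k l = 0" "D i k j l = 0 \<longleftrightarrow> D i j k l = 0"
    "D i j l k = 0 \<longleftrightarrow> D i j k l = 0" for i j k l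
    by (metis D neg_equal_0_iff_equal)+
  have "{1..4::nat} = {1, 2, 3, 4}" by auto
  then have mem: "i \<in> {1, 2, 3, 4}" "m \<in> {1, 2, 3, 4}" "k \<in> {1, 2, 3, 4}" "l \<in> {1, 2, 3, 4}"
    using assms(1) by blast+
  \<comment> \<open>The rules \<open>zero\<close> are permutative, so rewriting with them sorts the
    arguments of \<open>D\<close> in every case.\<close>
  show ?thesis
    using mem assms(2) by (elim insertE emptyE; simp add: zero)
qed

text \<open>By \<open>w_nonzero\<close> one of the two remaining indices has nonzero
  \<open>w\<close>; it is named \<open>k\<close> and serves as pivot for both Pappus lines.\<close>

lemma obtain_remaining_indices:
  assumes "i \<in> {1..4::nat}" "m \<in> {1..4}" "i \<noteq> m"
  obtains k l where "{i, m, k, l} = {1..4}" "distinct [i, m, k, l]" "w k \<noteq> 0"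
proof -
  have "card ({1..4} - {i, m}) = 2" using assms by (simp add: card_Diff_subset)
  then obtain k l where kl: "{1..4} - {i, m} = {k, l}" "k \<noteq> l" by (meson card_2_iff)
  then have "{k, l} \<subseteq> {1..4}" "{k, l} \<inter> {i, m} = {}" by blast+
  then have mem: "k \<in> {1..4}" "l \<in> {1..4}" "distinct [i, m, k, l]" "distinct [i, m, l, k]"
    using assms(3) kl(2) by auto
  have "{1..4} = {i, m} \<union> ({1..4} - {i, m})" using assms by blast
  then have "{i, m, k, l} = {1..4}" unfolding kl(1) by blast
  moreover have "{i, m, l, k} = {i, m, k, l}" by blast
  moreover have "w k \<noteq> 0 \<or> w l \<noteq> 0" using mem(1,2) kl(2) by (rule w_nonzero)
  ultimately show ?thesis using mem(3,4) that by metis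
qed

lemma ex1_pappus_line:
  assumes "i \<in> {1..4}"
  shows "\<exists>!g. is_pappus_line A B i g"
proof -
  obtain m where m: "m \<in> {1..4::nat}" "i \<noteq> m" by (rule obtain_other_index)
  obtain k l where "{i, m, k, l} = {1..4}" "distinct [i, m, k, l]" "w k \<noteq> 0"
    using obtain_remaining_indices[OF assms m] .
  from is_pappus_line_iff[OF this] show ?thesis by simp
qed

text \<open>Both lines contain \<open>P k l\<close>. They agree iff \<open>P i k\<close>, a second
  point of the line for \<open>m\<close>, lies on the line for \<open>i\<close>, and
  \<open>triple_P\<close> evaluates this incidence.\<close>

lemma pappus_line_eq_iff:
  assumes "i \<in> {1..4}" "m \<in> {1..4}" "i \<noteq> m"
  shows "pappus_line A B i = pappus_line A B m \<longleftrightarrow> D 1 2 3 4 = 0"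
proof -
  obtain k l where kl: "{i, m, k, l} = {1..4}" "distinct [i, m, k, l]" "w k \<noteq> 0"
    using obtain_remaining_indices[OF assms] .
  have kl': "{m, i, k, l} = {1..4}" "distinct [m, i, k, l]" using kl by auto
  have mem: "i \<in> {1..4}" "m \<in> {1..4}" "k \<in> {1..4}" "l \<in> {1..4}"
    unfolding kl(1)[symmetric] by simp_all
  let ?h = "\<lambda>m. {x. cross3 (P m k) (P k l) \<bullet> x = 0}"
  have pi: "pappus_line A B i = ?h m"
    unfolding pappus_line_def is_pappus_line_iff[OF kl] by simp
  have pm: "pappus_line A B m = ?h i"
    unfolding pappus_line_def is_pappus_line_iff[OF kl' kl(3)] by simp
  have nz: "cross3 (P m k) (P k l) \<noteq> 0" "cross3 (P i k) (P k l) \<noteq> 0"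
    using cross3_P_nonzero[of _ k l] kl(2,3) mem by auto
  have "?h m = ?h i \<longleftrightarrow> P i k \<in> ?h m"
  proof
    assume "?h m = ?h i"
    moreover have "P i k \<in> ?h i" by (simp add: dot_cross_self)
    ultimately show "P i k \<in> ?h m" by blast
  next
    assume "P i k \<in> ?h m"
    moreover have "P k l \<in> ?h m" by (simp add: dot_cross_self)
    ultimately show "?h m = ?h i"
      by (rule cross3_hyperplane_eq[OF proj_line_hyperplane[OF nz(1)] _ _ nz(2)])
  qed
  also have "\<dots> \<longleftrightarrow> D i m k l = 0"
    using kl(3) basis by (simp add: triple_P)
  finally show ?thesis unfolding pi pm D_perm[OF kl(1,2)] .
qed

text \<open>Clearing the nonzero denominators gives exactly the difference of products that defines
  \<open>D 1 2 3 4\<close>.\<close>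

lemma cross_ratio_eq_iff:
  "cross_ratio (A 1) (A 2) (A 3) (A 4) = cross_ratio (B 1) (B 2) (B 3) (B 4) \<longleftrightarrow> D 1 2 3 4 = 0"
proof -
  have "cross3 e0 e1 \<bullet> e2 = - (cross3 e0 e2 \<bullet> e1)"
    by (simp add: cross3_def inner_vec_def sum_3 algebra_simps)
  then have c: "cross3 e0 e1 \<noteq> 0" "cross3 e0 e2 \<noteq> 0"
    using basis by auto
  have nz: "p i \<noteq> 0 \<or> q i \<noteq> 0" "r i \<noteq> 0 \<or> s i \<noteq> 0" if i: "i \<in> {1..4}" for i
  proof -
    obtain j where "j \<in> {1..4::nat}" "i \<noteq> j" by (rule obtain_other_index)
    then show "p i \<noteq> 0 \<or> q i \<noteq> 0" "r i \<noteq> 0 \<or> s i \<noteq> 0"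
      using A_bracket[OF i] B_bracket[OF i] by fastforce+
  qed
  have denom: "(p 3 * q 2 - p 2 * q 3) * (p 4 * q 1 - p 1 * q 4) \<noteq> 0"
    "(r 3 * s 2 - r 2 * s 3) * (r 4 * s 1 - r 1 * s 4) \<noteq> 0"
    using A_bracket[of 3 2] A_bracket[of 4 1] B_bracket[of 3 2] B_bracket[of 4 1] by auto
  have "cross_ratio (A 1) (A 2) (A 3) (A 4) =
    ((p 1 * q 3 - p 3 * q 1) * (p 2 * q 4 - p 4 * q 2)) /
    ((p 3 * q 2 - p 2 * q 3) * (p 4 * q 1 - p 1 * q 4))"
    using cross3_nonzero_imp_independent[OF c(1)] nz(1) A by (rule cross_ratio_homogeneous)
  moreover have "cross_ratio (B 1) (B 2) (B 3) (B 4) =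
    ((r 1 * s 3 - r 3 * s 1) * (r 2 * s 4 - r 4 * s 2)) /
    ((r 3 * s 2 - r 2 * s 3) * (r 4 * s 1 - r 1 * s 4))"
    using cross3_nonzero_imp_independent[OF c(2)] nz(2) B by (rule cross_ratio_homogeneous)
  ultimately show ?thesis
    by (simp only: frac_eq_eq[OF denom] D_def right_minus_eq)
qed

end

section \<open>Coordinates for the given configuration\<close>

lemma line_coordinates:
  assumes "proj_line g" "e \<in> g" "e \<noteq> 0"
  obtains f where "g = span {e, f}" "cross3 e f \<noteq> 0"
proof -
  have "dim (span {e}) = 1" using assms(3) by simp
  moreover have "dim g = 2" using assms(1) by (simp add: proj_line_def)
  ultimately have "\<not> g \<subseteq> span {e}" using dim_subset[of g "span {e}"] by auto
  then obtain f where f: "f \<in> g" "f \<notin> span {e}" by blast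
  have "cross3 e f \<noteq> 0"
    using f(2) assms(3) span_base[of e "{e}"]
    by (auto simp: cross_eq_0 collinear_lemma span_zero intro: span_scale)
  note ind = cross3_nonzero_imp_independent[OF this]
  moreover have "span {e, f} = g"
    using assms(1,2) f(1) ind
    by (intro subspace_dim_equal) (auto simp: proj_line_def span_minimal dim_eq_card_independent)
  ultimately show ?thesis using that \<open>cross3 e f \<noteq> 0\<close> by blast
qed

lemma points_coordinates:
  fixes X :: "nat \<Rightarrow> (real^3) set"
  assumes "\<And>i. i \<in> I \<Longrightarrow> proj_point (X i) \<and> X i \<subseteq> span {e, f}"
  obtains p q where "\<And>i. i \<in> I \<Longrightarrow> X i = span {p i *\<^sub>R e + q i *\<^sub>R f} \<and> p i *\<^sub>R e + q i *\<^sub>R f \<noteq> 0"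
proof -
  have "\<exists>c d. X i = span {c *\<^sub>R e + d *\<^sub>R f} \<and> c *\<^sub>R e + d *\<^sub>R f \<noteq> 0" if i: "i \<in> I" for i
  proof -
    obtain x where x: "x \<noteq> 0" "X i = span {x}"
      using assms[OF i] proj_point_obtain by blast
    then have "x \<in> span {e, f}" using assms[OF i] span_base by blast
    then obtain c where "x - c *\<^sub>R e \<in> span {f}" by (auto simp: span_breakdown_eq)
    then obtain d where "x - c *\<^sub>R e = d *\<^sub>R f" by (auto simp: span_singleton)
    then have "x = c *\<^sub>R e + d *\<^sub>R f" by (simp add: algebra_simps)
    then show ?thesis using x by blast
  qed
  then show ?thesis using that by metis
qed

lemma bracket_nonzero:
  fixes e f :: "real^3"
  assumes "c *\<^sub>R e + d *\<^sub>R f \<noteq> 0" "c' *\<^sub>R e + d' *\<^sub>R f \<noteq> 0"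
    and "span {c *\<^sub>R e + d *\<^sub>R f} \<noteq> span {c' *\<^sub>R e + d' *\<^sub>R f}"
  shows "c * d' - c' * d \<noteq> 0"
proof
  assume 0: "c * d' - c' * d = 0"
  have "cross3 (c *\<^sub>R e + d *\<^sub>R f) (c' *\<^sub>R e + d' *\<^sub>R f) = (c * d' - c' * d) *\<^sub>R cross3 e f"
    by (simp add: cross3_simps forall_3)
  then have "cross3 (c *\<^sub>R e + d *\<^sub>R f) (c' *\<^sub>R e + d' *\<^sub>R f) = 0"
    using 0 by simp
  with assms(1,2) obtain t where "c' *\<^sub>R e + d' *\<^sub>R f = t *\<^sub>R (c *\<^sub>R e + d *\<^sub>R f)"
    unfolding cross_eq_0 collinear_lemma by auto
  then show False
    using span_singleton_eqI assms(2,3) by (metis scaleR_zero_left)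
qed

theorem corollary10:
  fixes A B :: "nat \<Rightarrow> (real^3) set" and a b :: "(real^3) set"
  assumes "proj_line a" "proj_line b" "a \<noteq> b"
    and "\<And>i. i \<in> {1..4} \<Longrightarrow> proj_point (A i) \<and> A i \<subseteq> a"
    and "\<And>i. i \<in> {1..4} \<Longrightarrow> proj_point (B i) \<and> B i \<subseteq> b"
    and "inj_on A {1..4}" "inj_on B {1..4}"
    and "\<And>j k. j \<in> {1..4} \<Longrightarrow> k \<in> {1..4} \<Longrightarrow> j \<noteq> k \<Longrightarrow> A j \<noteq> B k"
  shows "(\<forall>i\<in>{1..4}. \<exists>!p. is_pappus_line A B i p) \<and>
    ((\<exists>i\<in>{1..4}. \<exists>j\<in>{1..4}. i \<noteq> j \<and> pappus_line A B i = pappus_line A B j) \<longleftrightarrow>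
       cross_ratio (A 1) (A 2) (A 3) (A 4) = cross_ratio (B 1) (B 2) (B 3) (B 4)) \<and>
    ((\<forall>i\<in>{1..4}. \<forall>j\<in>{1..4}. pappus_line A B i = pappus_line A B j) \<longleftrightarrow>
       cross_ratio (A 1) (A 2) (A 3) (A 4) = cross_ratio (B 1) (B 2) (B 3) (B 4))"
proof -
  obtain e0 where e0: "e0 \<noteq> 0" "meet a b = span {e0}"
    using proj_point_obtain[OF proj_point_meet[OF assms(1-3)]] .
  have "e0 \<in> meet a b" unfolding e0(2) by (simp add: span_base)
  then have e0ab: "e0 \<in> a" "e0 \<in> b" by (auto simp: meet_def)
  obtain e1 where e1: "a = span {e0, e1}" "cross3 e0 e1 \<noteq> 0"
    using line_coordinates[OF assms(1) e0ab(1) e0(1)] .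
  obtain e2 where e2: "b = span {e0, e2}" "cross3 e0 e2 \<noteq> 0"
    using line_coordinates[OF assms(2) e0ab(2) e0(1)] .
  \<comment> \<open>Otherwise \<open>e2\<close> lies on \<open>a\<close>, and both lines contain the
    independent vectors \<open>e0\<close> and \<open>e2\<close>.\<close>
  have basis: "cross3 e0 e1 \<bullet> e2 \<noteq> 0"
  proof
    have "e1 \<in> a" "e2 \<in> b" unfolding e1(1) e2(1) by (auto intro: span_base)
    moreover assume "cross3 e0 e1 \<bullet> e2 = 0"
    ultimately have "e2 \<in> a" "e2 \<in> b"
      using cross3_hyperplane_eq[OF assms(1) e0ab(1) _ e1(2)] by auto
    then have "a = b"
      using cross3_hyperplane_eq[OF assms(1) e0ab(1) _ e2(2)]
        cross3_hyperplane_eq[OF assms(2) e0ab(2) _ e2(2)] by simp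
    then show False using assms(3) by simp
  qed
  obtain p q where pq:
    "\<And>i. i \<in> {1..4} \<Longrightarrow> A i = span {p i *\<^sub>R e0 + q i *\<^sub>R e1} \<and> p i *\<^sub>R e0 + q i *\<^sub>R e1 \<noteq> 0"
    using points_coordinates[of "{1..4}" A e0 e1] assms(4) unfolding e1(1) by blast
  obtain r s where rs:
    "\<And>i. i \<in> {1..4} \<Longrightarrow> B i = span {r i *\<^sub>R e0 + s i *\<^sub>R e2} \<and> r i *\<^sub>R e0 + s i *\<^sub>R e2 \<noteq> 0"
    using points_coordinates[of "{1..4}" B e0 e2] assms(5) unfolding e2(1) by blast
  interpret pappus_coords e0 e1 e2 p q r s A B
  proof
    fix i j :: nat
    assume ij: "i \<in> {1..4}" "j \<in> {1..4}" "i \<noteq> j"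
    show "p i * q j - p j * q i \<noteq> 0"
      using pq[OF ij(1)] pq[OF ij(2)] inj_onD[OF assms(6) _ ij(1,2)] ij(3)
      by (intro bracket_nonzero[of _ e0 _ e1]) auto
    show "r i * s j - r j * s i \<noteq> 0"
      using rs[OF ij(1)] rs[OF ij(2)] inj_onD[OF assms(7) _ ij(1,2)] ij(3)
      by (intro bracket_nonzero[of _ e0 _ e2]) auto
    show "q i \<noteq> 0 \<or> s j \<noteq> 0"
    proof (rule ccontr)
      assume "\<not> (q i \<noteq> 0 \<or> s j \<noteq> 0)"
      then have "A i = span {p i *\<^sub>R e0}" "p i \<noteq> 0" "B j = span {r j *\<^sub>R e0}" "r j \<noteq> 0"
        using pq[OF ij(1)] rs[OF ij(2)] by auto
      then have "A i = B j"
        using span_singleton_eqI[OF refl, of _ e0] by metis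
      then show False using assms(8)[OF ij] by simp
    qed
  qed (use basis pq rs assms(4,5,8) in auto)
  \<comment> \<open>The condition on \<open>D\<close> is the same for every pair of distinct
    indices. As such a pair exists, the existential and the universal statement are
    equivalent.\<close>
  have ex: "\<exists>i\<in>{1..4::nat}. \<exists>j\<in>{1..4}. i \<noteq> j"
    by (intro bexI[of _ 1] bexI[of _ 2]) simp_all
  have "(\<exists>i\<in>{1..4}. \<exists>j\<in>{1..4}. i \<noteq> j \<and> pappus_line A B i = pappus_line A B j) \<longleftrightarrow> D 1 2 3 4 = 0"
    using ex pappus_line_eq_iff by blast
  moreover have "(\<forall>i\<in>{1..4}. \<forall>j\<in>{1..4}. pappus_line A B i = pappus_line A B j) \<longleftrightarrow> D 1 2 3 4 = 0"
    using ex pappus_line_eq_iff by blast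
  ultimately show ?thesis
    using ex1_pappus_line cross_ratio_eq_iff by simp
qed

end
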